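(* Let $(P_N(Z))_{N\ge 1}$ be a sequence of polynomials with complex coefficients, $P_N(Z)=\sum_{k=0}^{N} a_{N,k}Z^k$, such that $a_{N,0}\,a_{N,N}\neq 0$ for all $N$. Let $$L_N(P_N)=\log\left(\sum_{k=0}^{N}|a_{N,k}|\right)-\frac12\log|a_{N,0}|-\frac12\log|a_{N,N}|.$$ If $L_N(P_N)=o(N)$ as $N\to\infty$, then for all $0<\rho<1$, $$\lim_{N\to\infty}\frac1N\,\nu_N(\rho)=1,$$ and for all $0\le\theta<\phi\le 2\pi$, $$\lim_{N\to\infty}\frac1N\,\nu_N(\theta,\phi)=\frac{\phi-\theta}{2\pi}.$$
   Context: Let $z_1,\dots,z_N$ be the complex zeros of $P_N$, counted with multiplicity. For $0<\rho<1$, $\nu_N(\rho)=\#\{k: 1-\rho\le |z_k|\le \frac{1}{1-\rho}\}$. For $0\le\theta<\phi\le 2\pi$, $\nu_N(\theta,\phi)=\#\{k:\theta\le\arg(z_k)<\phi\}$, where the argument takes values in $[0,2\pi)$. *)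

theory Defs
  imports
    "HOL-Analysis.Analysis"
    "HOL-Computational_Algebra.Polynomial"
    "HOL-Library.Landau_Symbols"
begin

definition L_functional :: "nat \<Rightarrow> complex poly \<Rightarrow> real" where
  "L_functional N p =
     ln (\<Sum>k\<le>N. norm (coeff p k)) - 1/2 * ln (norm (coeff p 0)) - 1/2 * ln (norm (coeff p N))"

(* proots p is the multiset of zeros of p, so size counts with multiplicity. *)

definition nu_annulus :: "complex poly \<Rightarrow> real \<Rightarrow> nat" where
  "nu_annulus p \<rho> = size {# z \<in># proots p. 1 - \<rho> \<le> norm z \<and> norm z \<le> 1 / (1 - \<rho>) #}"

(* Arg2pi is the argument with values in [0, 2 * pi). *)

definition nu_sector :: "complex poly \<Rightarrow> real \<Rightarrow> real \<Rightarrow> nat" where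
  "nu_sector p \<theta> \<phi> = size {# z \<in># proots p. \<theta> \<le> Arg2pi z \<and> Arg2pi z < \<phi> #}"

end

theory Submission
  imports
    Defs
    "HOL-Complex_Analysis.Conformal_Mappings"
    "HOL-Computational_Algebra.Fundamental_Theorem_Algebra"
begin

text \<open>
  Let \<open>Z\<close> be the multiset of roots of a polynomial of degree \<open>N\<close>, and let \<open>L\<close> be its
  \<open>L_functional\<close>. On the unit circle the modulus of the polynomial is at most the sum of the moduli of
  the coefficients, and after normalisation this says that the product of \<open>norm (z - w) / sqrt (norm w)\<close>
  over the roots \<open>w\<close> is at most \<open>exp L\<close> (\<open>prod_roots_le_exp_L_functional\<close>). Both
  claims follow from this single bound, since \<open>L\<close> is small compared with \<open>N\<close>.

  For the moduli, Jensen's inequality gives \<open>(\<Sum>w\<in>#Z. \<bar>ln (norm w)\<bar>) \<le> 2 * L\<close>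
  (\<open>sum_abs_ln_norm_le\<close>). Every root outside the annulus contributes at least \<open>- ln (1 - \<rho>)\<close> to this
  sum, so there are only \<open>O(L)\<close> such roots.

  For the arguments, following Schur, the bound survives when each root \<open>w\<close> is projected to
  \<open>u = sgn w\<close> on the circle (\<open>norm_diff_sgn_le\<close>), and by the maximum modulus principle it extends to the disc.
  There the logarithm of the product has real part at most \<open>L\<close>, and its Taylor coefficients are,
  up to conjugation and sign, the power sums of the \<open>u\<close> divided by their exponents. Taylor
  coefficients of a function whose real part is bounded above are bounded as well, which yields \<open>norm (\<Sum>u. u ^ m) \<le> 2 * m * L\<close>
  (\<open>norm_power_sum_le\<close>). So for every fixed \<open>m > 0\<close> the average of \<open>u ^ m\<close> tends to \<open>0\<close>, and
  Weyl's criterion (\<open>arc_ratio_tendsto\<close>) gives equidistribution of the arguments.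
\<close>

section \<open>Products over multisets and the maximum modulus principle\<close>

lemma norm_prod_mset:
  fixes f :: "'a \<Rightarrow> 'b::real_normed_field"
  shows "norm (\<Prod>x\<in>#A. f x) = (\<Prod>x\<in>#A. norm (f x))"
  by (induction A) (auto simp: norm_mult)

lemma holomorphic_on_prod_mset:
  assumes "\<And>x. x \<in># A \<Longrightarrow> f x holomorphic_on S"
  shows "(\<lambda>z. \<Prod>x\<in>#A. f x z) holomorphic_on S"
  using assms by (induction A) (auto intro!: holomorphic_intros)

lemma prod_mset_mono_real:
  fixes f g :: "'a \<Rightarrow> real"
  assumes "\<And>x. x \<in># A \<Longrightarrow> 0 \<le> f x \<and> f x \<le> g x"
  shows "0 \<le> (\<Prod>x\<in>#A. f x) \<and> (\<Prod>x\<in>#A. f x) \<le> (\<Prod>x\<in>#A. g x)"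
  using assms by (induction A) (auto intro!: mult_mono, force)

lemma prod_mset_exp: "(\<Prod>x\<in>#A. exp (f x)) = exp (\<Sum>x\<in>#A. f x :: 'b::{real_normed_field,banach})"
  by (induction A) (auto simp: exp_add)

lemma norm_le_on_disc_if_on_circle:
  fixes f :: "complex \<Rightarrow> complex"
  assumes hol: "f holomorphic_on UNIV"
    and le: "\<And>z. norm z = 1 \<Longrightarrow> norm (f z) \<le> B"
    and z: "norm z \<le> 1"
  shows "norm (f z) \<le> B"
proof (rule maximum_modulus_frontier[of f "cball 0 1"])
  show "f holomorphic_on interior (cball 0 1)"
    using hol holomorphic_on_subset by blast
  show "continuous_on (closure (cball 0 1)) f"
    using hol holomorphic_on_imp_continuous_on continuous_on_subset by blast
qed (use le z in auto)

section \<open>Moduli of the roots\<close>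

text \<open>
  Replacing the factor \<open>z - w\<close> by \<open>1 - cnj w * z\<close> moves a root \<open>w \<noteq> 0\<close> to its mirror image
  \<open>1 / cnj w\<close> in the unit circle without changing the modulus on the circle.
\<close>

lemma norm_reflected_factor:
  fixes z w :: complex
  assumes "norm z = 1"
  shows "norm (1 - cnj w * z) = norm (z - w)"
proof -
  have "z * cnj z = 1"
    using assms by (simp add: complex_norm_square[symmetric])
  hence "1 - cnj w * z = z * cnj (z - w)"
    by (simp add: algebra_simps)
  thus ?thesis
    using assms by (simp add: norm_mult del: complex_cnj_diff)
qed

text \<open>
  This is Jensen's formula in the form of an inequality. Reflect all roots inside the unit disc
  to the outside. The resulting product \<open>F\<close> has the same modulus on the circle, so
  \<open>norm (F 0) \<le> exp L\<close> by the maximum modulus principle. At \<open>0\<close> a root \<open>w\<close> with \<open>norm w \<ge> 1\<close> now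
  contributes \<open>norm w / sqrt (norm w)\<close> and any other root contributes \<open>1 / sqrt (norm w)\<close>; both are
  \<open>exp (\<bar>ln (norm w)\<bar> / 2)\<close>.
\<close>

lemma sum_abs_ln_norm_le:
  fixes Z :: "complex multiset"
  assumes nz: "0 \<notin># Z"
    and le: "\<And>z. norm z = 1 \<Longrightarrow> (\<Prod>w\<in>#Z. norm (z - w) / sqrt (norm w)) \<le> exp L"
  shows "(\<Sum>w\<in>#Z. \<bar>ln (norm w)\<bar>) \<le> 2 * L"
proof -
  define b where "b w z = (if norm w \<ge> 1 then z - w else 1 - cnj w * z) / of_real (sqrt (norm w))"
    for w z :: complex
  define F where "F z = (\<Prod>w\<in>#Z. b w z)" for z
  have hol: "F holomorphic_on UNIV"
  proof -
    have "b w holomorphic_on UNIV" if "w \<in># Z" for w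
      using nz that by (cases "norm w \<ge> 1") (auto simp: b_def[abs_def] intro!: holomorphic_intros)
    thus ?thesis
      unfolding F_def by (intro holomorphic_on_prod_mset)
  qed
  have b_circle: "norm (b w z) = norm (z - w) / sqrt (norm w)" if "norm z = 1" for w z
    using norm_reflected_factor[OF that] by (simp add: b_def norm_divide)
  have b0: "norm (b w 0) = exp (\<bar>ln (norm w)\<bar> / 2)" if "w \<noteq> 0" for w
  proof -
    have pos: "norm w > 0" using that by simp
    have s: "sqrt (norm w) = exp (ln (norm w) / 2)"
      using pos by (simp flip: ln_sqrt)
    show ?thesis
    proof (cases "norm w \<ge> 1")
      case True
      have "norm (b w 0) = norm w / sqrt (norm w)"
        using True by (simp add: b_def norm_divide)
      also have "\<dots> = sqrt (norm w)" by (rule real_div_sqrt) simp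
      finally show ?thesis using True s by simp
    next
      case False
      hence "ln (norm w) \<le> 0" using pos by simp
      thus ?thesis using False by (simp add: b_def norm_divide s exp_minus inverse_eq_divide)
    qed
  qed
  have "(\<Sum>w\<in>#V. \<bar>ln (norm w)\<bar>) / 2 = (\<Sum>w\<in>#V. \<bar>ln (norm w)\<bar> / 2)" for V :: "complex multiset"
    by (induction V) (simp_all add: add_divide_distrib)
  hence "exp ((\<Sum>w\<in>#Z. \<bar>ln (norm w)\<bar>) / 2) = exp (\<Sum>w\<in>#Z. \<bar>ln (norm w)\<bar> / 2)"
    by simp
  also have "\<dots> = (\<Prod>w\<in>#Z. exp (\<bar>ln (norm w)\<bar> / 2))"
    by (rule prod_mset_exp[symmetric])
  also have "\<dots> = (\<Prod>w\<in>#Z. norm (b w 0))"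
    using nz by (intro arg_cong[of _ _ prod_mset] image_mset_cong) (metis b0)
  also have "\<dots> = norm (F 0)"
    by (simp add: F_def norm_prod_mset)
  also have "norm (F 0) \<le> exp L"
  proof (rule norm_le_on_disc_if_on_circle[OF hol])
    fix z :: complex assume "norm z = 1"
    thus "norm (F z) \<le> exp L"
      using le[of z] by (simp add: F_def norm_prod_mset b_circle)
  qed simp
  finally show ?thesis by simp
qed

lemma size_outside_annulus_le:
  fixes Z :: "complex multiset"
  assumes nz: "0 \<notin># Z" and \<rho>: "0 < \<rho>" "\<rho> < 1"
  shows "real (size {#w \<in># Z. \<not> (1 - \<rho> \<le> norm w \<and> norm w \<le> 1 / (1 - \<rho>))#}) * (- ln (1 - \<rho>))
           \<le> (\<Sum>w\<in>#Z. \<bar>ln (norm w)\<bar>)"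
  using nz
proof (induction Z)
  case (add w Z)
  define \<kappa> where "\<kappa> = - ln (1 - \<rho>)"
  have "\<kappa> \<le> \<bar>ln (norm w)\<bar>" if "\<not> (1 - \<rho> \<le> norm w \<and> norm w \<le> 1 / (1 - \<rho>))"
  proof -
    have w: "norm w > 0" using add.prems by simp
    from that consider "norm w \<le> 1 - \<rho>" | "1 / (1 - \<rho>) \<le> norm w" by linarith
    thus ?thesis
    proof cases
      case 1
      hence "ln (norm w) \<le> ln (1 - \<rho>)" using w by (intro ln_mono) auto
      thus ?thesis by (simp add: \<kappa>_def)
    next
      case 2
      hence "ln (1 / (1 - \<rho>)) \<le> ln (norm w)" using w \<rho> by (intro ln_mono) auto
      thus ?thesis using \<rho> by (simp add: \<kappa>_def ln_div)
    qed
  qed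
  with add show ?case by (auto simp: \<kappa>_def[symmetric] algebra_simps)
qed simp

section \<open>Power sums of the arguments of the roots\<close>

text \<open>
  Schur's device for moving a root to the unit circle along its ray: with \<open>r = norm w\<close>, the quantity
  \<open>(norm (z - w))\<^sup>2 / r - (norm (z - sgn w))\<^sup>2\<close> equals \<open>(r - 1)\<^sup>2 / r\<close>, whatever the angle between
  \<open>z\<close> and \<open>w\<close>. So projecting the roots radially onto the circle only decreases the normalised
  product.
\<close>

lemma norm_diff_sgn_le:
  fixes z w :: complex
  assumes z: "norm z = 1" and w: "w \<noteq> 0"
  shows "norm (z - sgn w) \<le> norm (z - w) / sqrt (norm w)"
proof -
  define r where "r = norm w"
  define c where "c = inner z (sgn w)"
  have r: "r > 0" using w by (simp add: r_def)
  have w': "w = r *\<^sub>R sgn w" using w by (simp add: r_def sgn_div_norm)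
  have s1: "inner (sgn w) (sgn w) = 1"
    using w by (simp add: norm_eq_1[symmetric] norm_sgn)
  have z1: "inner z z = 1" using z by (simp add: norm_eq_1)
  have A: "(norm (z - w))\<^sup>2 = 1 - 2 * r * c + r\<^sup>2"
  proof -
    have "(norm (z - w))\<^sup>2 = inner (z - r *\<^sub>R sgn w) (z - r *\<^sub>R sgn w)"
      using w' by (metis power2_norm_eq_inner)
    also have "\<dots> = 1 - 2 * r * c + r\<^sup>2"
      using s1 z1 by (simp add: inner_diff_left inner_diff_right c_def inner_commute power2_eq_square)
    finally show ?thesis .
  qed
  have B: "(norm (z - sgn w))\<^sup>2 = 2 - 2 * c"
    using s1 z1 by (simp add: power2_norm_eq_inner inner_diff_left inner_diff_right c_def inner_commute)
  have "(norm (z - sgn w))\<^sup>2 * r \<le> (norm (z - w))\<^sup>2"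
    using zero_le_power2[of "r - 1"] unfolding A B by (simp add: power2_eq_square algebra_simps)
  hence "(norm (z - sgn w) * sqrt r)\<^sup>2 \<le> (norm (z - w))\<^sup>2"
    using r by (simp add: power_mult_distrib)
  hence "norm (z - sgn w) * sqrt r \<le> norm (z - w)"
    by (rule power2_le_imp_le) simp
  thus ?thesis using r by (simp add: field_simps r_def)
qed

text \<open>
  Both sides are polynomials in \<open>x\<close> of degree at most \<open>m\<close>. They agree at the \<open>m\<close> roots of unity,
  where they vanish, and at \<open>0\<close>.
\<close>

lemma prod_roots_of_unity:
  fixes x :: complex
  assumes "m > 0"
  shows "(\<Prod>\<zeta> | \<zeta> ^ m = 1. 1 - \<zeta> * x) = 1 - x ^ m"
proof -
  define R where "R = {\<zeta>::complex. \<zeta> ^ m = 1}"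
  have fin: "finite R" and card: "card R = m"
    using assms finite_roots_unity[of m] card_complex_roots_unity[of m] by (auto simp: R_def)
  define p where "p = (\<Prod>\<zeta>\<in>R. [:1, -\<zeta>:])"
  define q where "q = 1 - monom (1::complex) m"
  have px: "poly p x = (\<Prod>\<zeta>\<in>R. 1 - \<zeta> * x)" for x
    by (simp add: p_def poly_prod mult.commute)
  have qx: "poly q x = 1 - x ^ m" for x
    by (simp add: q_def poly_monom)
  have "p = q"
  proof (rule poly_eqI_degree[of "insert 0 R"])
    fix x assume "x \<in> insert 0 R"
    then consider "x = 0" | "x \<in> R" by auto
    thus "poly p x = poly q x"
    proof cases
      case 2
      hence "inverse x \<in> R" "x \<noteq> 0" using assms by (auto simp: R_def power_inverse power_0_left)
      hence "poly p x = 0" unfolding px using fin by (intro prod_zero bexI[of _ "inverse x"]) auto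
      thus ?thesis using 2 by (simp add: qx R_def)
    qed (use assms in \<open>simp add: px qx\<close>)
  next
    have 0: "0 \<notin> R" using assms by (simp add: R_def power_0_left)
    have "degree p \<le> (\<Sum>\<zeta>\<in>R. degree [:1, -\<zeta>:])"
      unfolding p_def by (rule degree_prod_sum_le[OF fin, unfolded comp_def])
    also have "\<dots> \<le> (\<Sum>\<zeta>\<in>R. 1)" by (intro sum_mono) simp
    finally show "card (insert 0 R) > degree p" using 0 fin card by simp
    have "degree q \<le> m" unfolding q_def by (intro degree_diff_le) (auto simp: degree_monom_le)
    thus "card (insert 0 R) > degree q" using 0 fin card by simp
  qed
  thus ?thesis using px[of x] qx[of x] by (simp add: R_def)
qed

text \<open>
  The function \<open>f z = (\<Sum>u\<in>#U. Ln (1 - u * z))\<close> is a holomorphic logarithm of the product on the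
  disc, with \<open>f 0 = 0\<close>, derivative \<open>- (\<Sum>u\<in>#U. u)\<close> at \<open>0\<close> and real part at most \<open>A\<close>. Bounding that
  derivative by \<open>2 * A\<close> is the Borel--Caratheodory argument: the Moebius map
  \<open>\<zeta> \<mapsto> \<zeta> / (2 * B - \<zeta>)\<close> sends the half-plane \<open>Re \<zeta> < B\<close> to the unit disc and fixes \<open>0\<close>, and Schwarz's lemma
  applies to its composition with \<open>f\<close>.
\<close>

lemma norm_sum_le_if_prod_le:
  fixes U :: "complex multiset"
  assumes unit: "\<And>u. u \<in># U \<Longrightarrow> norm u = 1"
    and le: "\<And>z. norm z < 1 \<Longrightarrow> norm (\<Prod>u\<in>#U. 1 - u * z) \<le> exp A"
  shows "norm (\<Sum>u\<in>#U. u) \<le> 2 * A"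
proof -
  define f where "f z = (\<Sum>u\<in>#U. Ln (1 - u * z))" for z
  have Re_pos: "Re (1 - u * z) > 0" if "u \<in># U" "norm z < 1" for u z
  proof -
    have "Re (u * z) \<le> norm (u * z)" by (rule complex_Re_le_cmod)
    also have "\<dots> < 1" using that unit by (simp add: norm_mult)
    finally show ?thesis by simp
  qed
  hence nonpos: "1 - u * z \<notin> \<real>\<^sub>\<le>\<^sub>0" if "u \<in># U" "norm z < 1" for u z
    using that by (metis complex_nonpos_Reals_iff leD)
  have deriv_Ln: "((\<lambda>z. Ln (1 - u * z)) has_field_derivative - u / (1 - u * z)) (at z)"
    if "u \<in># U" "norm z < 1" for u z
    using nonpos[OF that] by (auto intro!: derivative_eq_intros simp: field_simps)
  have deriv_f: "(f has_field_derivative (\<Sum>u\<in>#U. - u / (1 - u * z))) (at z)"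
    if "norm z < 1" for z
  proof -
    have "((\<lambda>z. \<Sum>u\<in>#V. Ln (1 - u * z)) has_field_derivative (\<Sum>u\<in>#V. - u / (1 - u * z))) (at z)"
      if "V \<subseteq># U" for V
      using that
    proof (induction V)
      case (add u V)
      have "u \<in># U" "V \<subseteq># U"
        using add.prems by (auto dest: mset_subset_eq_insertD subset_mset.less_imp_le)
      thus ?case
        using DERIV_add[OF deriv_Ln[OF _ \<open>norm z < 1\<close>] add.IH] by simp
    qed simp
    thus ?thesis unfolding f_def by simp
  qed
  have exp_f: "exp (f z) = (\<Prod>u\<in>#U. 1 - u * z)" if "norm z < 1" for z
  proof -
    have "exp (f z) = (\<Prod>u\<in>#U. exp (Ln (1 - u * z)))"
      unfolding f_def by (rule prod_mset_exp[symmetric])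
    also have "\<dots> = (\<Prod>u\<in>#U. 1 - u * z)"
    proof (intro arg_cong[of _ _ prod_mset] image_mset_cong)
      fix u assume "u \<in># U"
      hence "1 - u * z \<noteq> 0" using nonpos[OF _ that, of u] by (metis nonpos_Reals_zero_I)
      thus "exp (Ln (1 - u * z)) = 1 - u * z" by simp
    qed
    finally show ?thesis .
  qed
  have Re_f: "Re (f z) \<le> A" if "norm z < 1" for z
    using le[OF that] by (simp add: exp_f[OF that, symmetric])
  have f0: "f 0 = 0" by (simp add: f_def)
  have A: "A \<ge> 0" using Re_f[of 0] f0 by simp
  show ?thesis
  proof (rule field_le_epsilon)
    fix e :: real assume e: "e > 0"
    \<comment> \<open>A bound \<open>B\<close> strictly above \<open>A\<close> keeps \<open>Re (f z) < B\<close> strict and avoids division by zero for \<open>A = 0\<close>.\<close>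
    define B where "B = A + e / 2"
    have B: "B > A" "B > 0" using e A by (auto simp: B_def)
    define g where "g z = f z / (2 * B - f z)" for z
    have den: "2 * B - f z \<noteq> 0" if "norm z < 1" for z
    proof
      assume "2 * B - f z = 0"
      hence "Re (f z) = 2 * B" by (simp add: complex_eq_iff)
      thus False using Re_f[OF that] B by simp
    qed
    have "(g has_field_derivative (- (\<Sum>u\<in>#U. u)) / (2 * B)) (at 0)"
    proof -
      have "(\<Sum>u\<in>#U. - u / (1 - u * 0)) = - (\<Sum>u\<in>#U. u)"
        by (induction U) auto
      hence "(f has_field_derivative - (\<Sum>u\<in>#U. u)) (at 0)"
        using deriv_f[of 0] by simp
      from DERIV_divide[OF this DERIV_diff[OF DERIV_const this], of "2 * B"] show ?thesis
        using B f0 by (simp add: g_def[abs_def])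
    qed
    hence g': "deriv g 0 = (- (\<Sum>u\<in>#U. u)) / (2 * B)" by (rule DERIV_imp_deriv)
    have "f holomorphic_on ball 0 1"
      using deriv_f by (intro holomorphic_onI) (auto simp: field_differentiable_def intro: has_field_derivative_at_within)
    hence hol: "g holomorphic_on ball 0 1"
      unfolding g_def using den by (auto intro!: holomorphic_intros)
    have "norm (deriv g 0) \<le> 1"
    proof (rule Schwarz_Lemma(2)[OF hol, of 0])
      fix z :: complex assume z: "norm z < 1"
      have "(norm (f z))\<^sup>2 < (norm (2 * B - f z))\<^sup>2"
      proof -
        have "0 < 4 * B * (B - Re (f z))" using Re_f[OF z] B by simp
        also have "\<dots> = (norm (2 * B - f z))\<^sup>2 - (norm (f z))\<^sup>2"
          unfolding cmod_power2 by (simp add: power2_eq_square algebra_simps)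
        finally show ?thesis by simp
      qed
      hence "norm (f z) < norm (2 * B - f z)" by (rule power_less_imp_less_base) simp
      moreover from this have "0 < norm (2 * B - f z)"
        using norm_ge_zero order_le_less_trans by blast
      ultimately show "norm (g z) < 1" by (simp add: g_def norm_divide)
    qed (use f0 in \<open>auto simp: g_def\<close>)
    moreover have "norm (2 * complex_of_real B) = 2 * A + e"
      using B unfolding norm_mult by (simp add: B_def del: of_real_add of_real_divide)
    ultimately show "norm (\<Sum>u\<in>#U. u) \<le> 2 * A + e"
      using B by (simp add: g' norm_divide B_def)
  qed
qed

text \<open>
  For \<open>m = 1\<close> this is the previous lemma, applied to the conjugates \<open>cnj u\<close>. In general let \<open>\<zeta>\<close> run over the \<open>m\<close>-th roots of unity:
  the product of \<open>Q (\<zeta> * z)\<close> over all \<open>\<zeta>\<close> depends on \<open>z\<close> only through \<open>z ^ m\<close>, and as a function of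
  \<open>z ^ m\<close> its roots are the \<open>u ^ m\<close>. It has \<open>m\<close> factors, each at most \<open>exp A\<close>, which turns \<open>A\<close> into
  \<open>m * A\<close>.
\<close>

lemma norm_power_sum_le:
  fixes U :: "complex multiset"
  assumes unit: "\<And>u. u \<in># U \<Longrightarrow> norm u = 1"
    and m: "m > 0"
    and le: "\<And>z. norm z = 1 \<Longrightarrow> (\<Prod>u\<in>#U. norm (z - u)) \<le> exp A"
  shows "norm (\<Sum>u\<in>#U. u ^ m) \<le> 2 * (real m * A)"
proof -
  define Q where "Q z = (\<Prod>u\<in>#U. z - u)" for z
  have hol: "Q holomorphic_on UNIV"
    unfolding Q_def by (intro holomorphic_on_prod_mset holomorphic_intros)
  have Q_le: "norm (Q z) \<le> exp A" if "norm z \<le> 1" for z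
  proof (rule norm_le_on_disc_if_on_circle[OF hol _ that])
    show "norm (Q z) \<le> exp A" if "norm z = 1" for z
      using le[OF that] by (simp add: Q_def norm_prod_mset)
  qed
  have factor: "norm (z - u) = norm (1 - cnj u * z)" if "u \<in># U" for u z
  proof -
    have "u * cnj u = 1" using unit[OF that] by (simp add: complex_norm_square[symmetric])
    hence "z - u = u * (cnj u * z - 1)" by (simp add: algebra_simps)
    thus ?thesis using unit[OF that] by (simp add: norm_mult norm_minus_commute)
  qed
  have "norm (\<Sum>v\<in>#image_mset (\<lambda>u. cnj u ^ m) U. v) \<le> 2 * (real m * A)"
  proof (rule norm_sum_le_if_prod_le)
    fix w :: complex assume w: "norm w < 1"
    obtain z where z: "w = z ^ m" using m by (metis exists_complex_root less_numeral_extra(3))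
    have nz: "norm z < 1"
      using w m unfolding z norm_power by (metis one_le_power norm_ge_zero not_le)
    define R where "R = {\<zeta>::complex. \<zeta> ^ m = 1}"
    have nR: "norm \<zeta> = 1" if "\<zeta> \<in> R" for \<zeta>
    proof -
      have "norm \<zeta> ^ m = 1 ^ m" using that by (simp add: R_def flip: norm_power)
      from power_eq_imp_eq_base[OF this _ _ m] show ?thesis by simp
    qed
    have cR: "card R = m"
      using m card_complex_roots_unity[of m] by (auto simp: R_def)
    have "norm (\<Prod>v\<in>#image_mset (\<lambda>u. cnj u ^ m) U. 1 - v * w) = (\<Prod>u\<in>#U. norm (1 - (cnj u * z) ^ m))"
      by (simp add: norm_prod_mset z power_mult_distrib image_mset.compositionality comp_def)
    also have "\<dots> = (\<Prod>u\<in>#U. \<Prod>\<zeta>\<in>R. norm (1 - \<zeta> * (cnj u * z)))"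
      unfolding R_def by (simp add: prod_roots_of_unity[OF m, symmetric] prod_norm)
    also have "\<dots> = (\<Prod>u\<in>#U. \<Prod>\<zeta>\<in>R. norm (\<zeta> * z - u))"
      by (intro arg_cong[of _ _ prod_mset] image_mset_cong prod.cong) (simp_all add: factor mult_ac)
    also have "\<dots> = (\<Prod>\<zeta>\<in>R. \<Prod>u\<in>#U. norm (\<zeta> * z - u))"
      by (induction U) (simp_all add: prod.distrib)
    also have "\<dots> = (\<Prod>\<zeta>\<in>R. norm (Q (\<zeta> * z)))"
      by (simp add: Q_def norm_prod_mset)
    also have "\<dots> \<le> (\<Prod>\<zeta>\<in>R. exp A)"
      using nz by (intro prod_mono) (auto intro!: Q_le simp: norm_mult nR)
    also have "\<dots> = exp (real m * A)"
      by (simp add: cR exp_of_nat_mult)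
    finally show "norm (\<Prod>v\<in>#image_mset (\<lambda>u. cnj u ^ m) U. 1 - v * w) \<le> exp (real m * A)" .
  qed (auto simp: norm_power unit)
  also have "(\<Sum>v\<in>#image_mset (\<lambda>u. cnj u ^ m) U. v) = cnj (\<Sum>u\<in>#U. u ^ m)"
    by (induction U) simp_all
  finally show ?thesis by simp
qed

section \<open>Weyl's criterion on the unit circle\<close>

definition circle_mean :: "(complex \<Rightarrow> complex) \<Rightarrow> complex" where
  "circle_mean h = integral {0..2*pi} (\<lambda>t. h (cis t)) / (2 * pi)"

definition avg :: "complex multiset \<Rightarrow> (complex \<Rightarrow> complex) \<Rightarrow> complex" where
  "avg U h = (\<Sum>u\<in>#U. h u) / of_nat (size U)"

lemma continuous_on_cis_comp:
  assumes "continuous_on (sphere 0 1) h"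
  shows "continuous_on A (\<lambda>t. h (cis t))"
  by (rule continuous_on_compose2[OF assms]) (auto intro!: continuous_intros)

lemma integrable_cis_comp:
  fixes h :: "complex \<Rightarrow> 'b::banach"
  assumes "continuous_on (sphere 0 1) h"
  shows "(\<lambda>t. h (cis t)) integrable_on {a..b}"
  by (intro integrable_continuous_interval continuous_on_cis_comp assms)

lemma circle_mean_linear:
  assumes "continuous_on (sphere 0 1) g" "continuous_on (sphere 0 1) h"
  shows "circle_mean (\<lambda>z. \<alpha> * g z + \<beta> * h z) = \<alpha> * circle_mean g + \<beta> * circle_mean h"
proof -
  have "integral {0..2*pi} (\<lambda>t. \<alpha> * g (cis t) + \<beta> * h (cis t)) =
          integral {0..2*pi} (\<lambda>t. \<alpha> * g (cis t)) + integral {0..2*pi} (\<lambda>t. \<beta> * h (cis t))"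
    using assms by (intro integral_add integrable_cis_comp continuous_intros)
  thus ?thesis
    by (simp add: circle_mean_def add_divide_distrib)
qed

lemma avg_linear: "avg U (\<lambda>z. \<alpha> * g z + \<beta> * h z) = \<alpha> * avg U g + \<beta> * avg U h"
proof -
  have "(\<Sum>u\<in>#U. \<alpha> * g u + \<beta> * h u) = \<alpha> * (\<Sum>u\<in>#U. g u) + \<beta> * (\<Sum>u\<in>#U. h u)"
    by (induction U) (simp_all add: algebra_simps)
  thus ?thesis by (simp add: avg_def add_divide_distrib)
qed

lemma circle_mean_monomial:
  "circle_mean (\<lambda>z. z ^ j * cnj z ^ k) = (if j = k then 1 else 0)"
proof (cases "j = k")
  case True
  have "(\<lambda>t. cis t ^ j * cnj (cis t) ^ k) = (\<lambda>t. 1)"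
    by (simp add: True cis_cnj cis_mult flip: power_mult_distrib)
  thus ?thesis by (simp add: True circle_mean_def scaleR_conv_of_real)
next
  case False
  define d where "d = real j - real k"
  have d: "d \<noteq> 0" using False by (simp add: d_def)
  have eq: "cis t ^ j * cnj (cis t) ^ k = cis (d * t)" for t
    by (simp add: cis_cnj Complex.DeMoivre cis_mult d_def algebra_simps)
  have "((\<lambda>t. cis (d * t)) has_integral (cis (d * (2 * pi)) / (\<i> * d) - cis (d * 0) / (\<i> * d))) {0..2*pi}"
  proof (rule fundamental_theorem_of_calculus)
    fix t assume "t \<in> {0..2*pi}"
    have "((\<lambda>t. exp (\<i> * of_real d * t) / (\<i> * of_real d)) has_field_derivative exp (\<i> * of_real d * t)) (at t)" for t :: complex
      using d by (auto intro!: derivative_eq_intros)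
    hence "((\<lambda>t. exp (\<i> * of_real d * of_real t) / (\<i> * of_real d)) has_vector_derivative exp (\<i> * of_real d * of_real t)) (at t)"
      by (rule has_vector_derivative_real_field)
    thus "((\<lambda>t. cis (d * t) / (\<i> * d)) has_vector_derivative cis (d * t)) (at t within {0..2*pi})"
      by (simp add: cis_conv_exp mult.assoc has_vector_derivative_at_within)
  qed simp
  moreover have "cis (d * (2 * pi)) = 1"
    using cis_multiple_2pi[of d] by (simp add: d_def mult_ac)
  ultimately show ?thesis
    using False by (simp add: circle_mean_def eq integral_unique)
qed

text \<open>
  Continuity is part of the notion because \<open>circle_mean\<close> is additive only on integrable functions.
\<close>

definition averages_tendsto :: "'i filter \<Rightarrow> ('i \<Rightarrow> complex multiset) \<Rightarrow> (complex \<Rightarrow> complex) \<Rightarrow> bool" where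
  "averages_tendsto F U h \<longleftrightarrow>
     continuous_on (sphere 0 1) h \<and> ((\<lambda>i. avg (U i) h) \<longlongrightarrow> circle_mean h) F"

lemma averages_tendsto_linear:
  assumes "averages_tendsto F U g" "averages_tendsto F U h"
  shows "averages_tendsto F U (\<lambda>z. \<alpha> * g z + \<beta> * h z)"
  using assms unfolding averages_tendsto_def
  by (auto simp: avg_linear circle_mean_linear intro!: tendsto_intros continuous_intros)

text \<open>
  On the unit circle the monomial \<open>z ^ j * cnj z ^ k\<close> is an integer power of \<open>z\<close>, and negative powers
  are conjugates of positive ones, so power sums with positive exponents suffice.
\<close>

lemma averages_tendsto_monomial:
  assumes unit: "\<And>i u. u \<in># U i \<Longrightarrow> norm u = 1"
    and ne: "\<forall>\<^sub>F i in F. U i \<noteq> {#}"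
    and power_sums: "\<And>m. m > 0 \<Longrightarrow> ((\<lambda>i. avg (U i) (\<lambda>u. u ^ m)) \<longlongrightarrow> 0) F"
  shows "averages_tendsto F U (\<lambda>z. z ^ j * cnj z ^ k)"
proof -
  have uc: "u ^ l * cnj u ^ l = 1" if "u \<in># U i" for u i l
  proof -
    have "u * cnj u = 1" using unit[OF that] by (simp add: complex_norm_square[symmetric])
    thus ?thesis by (simp flip: power_mult_distrib)
  qed
  have cong: "avg (U i) g = avg (U i) h" if "\<And>u. u \<in># U i \<Longrightarrow> g u = h u" for i g h
    unfolding avg_def using that by (metis (mono_tags, lifting) image_mset_cong)
  have "((\<lambda>i. avg (U i) (\<lambda>z. z ^ j * cnj z ^ k)) \<longlongrightarrow> circle_mean (\<lambda>z. z ^ j * cnj z ^ k)) F"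
  proof (cases j k rule: linorder_cases)
    case equal
    have "avg (U i) (\<lambda>z. z ^ j * cnj z ^ k) = avg (U i) (\<lambda>z. 1)" for i
      by (rule cong) (simp add: uc equal)
    moreover have "\<forall>\<^sub>F i in F. avg (U i) (\<lambda>z. 1) = 1"
      using ne by eventually_elim (simp add: avg_def)
    ultimately show ?thesis
      by (simp add: circle_mean_monomial equal tendsto_eventually)
  next
    case greater
    have "avg (U i) (\<lambda>z. z ^ j * cnj z ^ k) = avg (U i) (\<lambda>z. z ^ (j - k))" for i
    proof (rule cong)
      fix u assume u: "u \<in># U i"
      have "u ^ j = u ^ (j - k) * u ^ k" using greater by (simp flip: power_add)
      thus "u ^ j * cnj u ^ k = u ^ (j - k)" using uc[OF u, of k] by (simp add: mult.assoc)
    qed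
    thus ?thesis using greater power_sums[of "j - k"] by (simp add: circle_mean_monomial)
  next
    case less
    have "avg (U i) (\<lambda>z. z ^ j * cnj z ^ k) = cnj (avg (U i) (\<lambda>z. z ^ (k - j)))" for i
    proof -
      have "avg (U i) (\<lambda>z. z ^ j * cnj z ^ k) = avg (U i) (\<lambda>z. cnj (z ^ (k - j)))"
      proof (rule cong)
        fix u assume u: "u \<in># U i"
        have "cnj u ^ k = cnj u ^ j * cnj u ^ (k - j)" using less by (simp flip: power_add)
        thus "u ^ j * cnj u ^ k = cnj (u ^ (k - j))" using uc[OF u, of j] by (simp add: mult.assoc[symmetric])
      qed
      also have "(\<Sum>u\<in>#V. cnj (u ^ (k - j))) = cnj (\<Sum>u\<in>#V. u ^ (k - j))" for V
        by (induction V) simp_all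
      hence "avg (U i) (\<lambda>z. cnj (z ^ (k - j))) = cnj (avg (U i) (\<lambda>z. z ^ (k - j)))"
        by (simp add: avg_def)
      finally show ?thesis .
    qed
    moreover have "((\<lambda>i. cnj (avg (U i) (\<lambda>z. z ^ (k - j)))) \<longlongrightarrow> cnj 0) F"
      using less by (intro tendsto_cnj power_sums) simp
    ultimately show ?thesis using less by (simp add: circle_mean_monomial)
  qed
  thus ?thesis by (auto simp: averages_tendsto_def intro!: continuous_intros)
qed

text \<open>
  The functions whose averages converge to their mean over the circle form a vector space, but it
  need not be closed under products, which blocks a direct induction over polynomial functions. The
  induction goes through for the space \<open>V\<close> of those \<open>h\<close> all of whose products with
  monomials have this property: multiplication by \<open>z\<close> and by
  \<open>cnj z\<close> preserves \<open>V\<close>, so the functions that multiply \<open>V\<close> into itself form an algebra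
  containing every real polynomial in \<open>Re z\<close> and \<open>Im z\<close>.
\<close>

lemma averages_tendsto_real_polynomial:
  assumes p: "real_polynomial_function p"
    and monomials: "\<And>j k. averages_tendsto F U (\<lambda>z. z ^ j * cnj z ^ k)"
  shows "averages_tendsto F U (\<lambda>z. of_real (p z))"
proof -
  define V where "V = {h. \<forall>j k. averages_tendsto F U (\<lambda>z. h z * (z ^ j * cnj z ^ k))}"
  have lin: "(\<lambda>z. \<alpha> * g z + \<beta> * h z) \<in> V" if "g \<in> V" "h \<in> V" for \<alpha> \<beta> g h
  proof -
    have "averages_tendsto F U (\<lambda>z. (\<alpha> * g z + \<beta> * h z) * (z ^ j * cnj z ^ k))" for j k
      using averages_tendsto_linear[of F U "\<lambda>z. g z * (z ^ j * cnj z ^ k)" "\<lambda>z. h z * (z ^ j * cnj z ^ k)" \<alpha> \<beta>] that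
      by (simp add: V_def algebra_simps)
    thus ?thesis by (simp add: V_def)
  qed
  have "(\<lambda>z. of_real (p z) * h z) \<in> V" if "h \<in> V" for h
    using p that
  proof (induction arbitrary: h)
    case (linear f)
    \<comment> \<open>The real-linear form \<open>f\<close> is twice the real part of \<open>\<alpha> * z\<close>.\<close>
    define \<alpha> where "\<alpha> = Complex (f 1 / 2) (- f \<i> / 2)"
    have f: "of_real (f z) = \<alpha> * z + cnj \<alpha> * cnj z" for z
    proof -
      interpret bounded_linear f by fact
      have "z = Re z *\<^sub>R 1 + Im z *\<^sub>R \<i>" by (simp add: complex_eq_iff)
      hence "f z = f (Re z *\<^sub>R 1 + Im z *\<^sub>R \<i>)" by (rule arg_cong)
      also have "\<dots> = Re z * f 1 + Im z * f \<i>" by (simp only: add scaleR real_scaleR_def)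
      finally show ?thesis by (simp add: \<alpha>_def complex_eq_iff)
    qed
    have "(\<lambda>z. z * h z) \<in> V"
      using linear.prems unfolding V_def
      by (auto, drule_tac x="Suc j" in spec, drule_tac x=k in spec, simp add: mult_ac)
    moreover have "(\<lambda>z. cnj z * h z) \<in> V"
      using linear.prems unfolding V_def
      by (auto, drule_tac x=j in spec, drule_tac x="Suc k" in spec, simp add: mult_ac)
    ultimately have "(\<lambda>z. \<alpha> * (z * h z) + cnj \<alpha> * (cnj z * h z)) \<in> V"
      by (rule lin)
    thus ?case by (simp add: f algebra_simps)
  next
    case (const c)
    show ?case using lin[OF const const, of "of_real c" 0] by simp
  next
    case (add f g)
    show ?case using lin[OF add.IH(1)[OF add.prems] add.IH(2)[OF add.prems], of 1 1]
      by (simp add: algebra_simps)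
  next
    case (mult f g)
    show ?case using mult.IH(1)[OF mult.IH(2)[OF mult.prems]] by (simp add: mult.assoc)
  qed
  moreover have "(\<lambda>z. 1) \<in> V" using monomials by (simp add: V_def)
  ultimately have "(\<lambda>z. of_real (p z) * 1) \<in> V" by blast
  hence "averages_tendsto F U (\<lambda>z. of_real (p z) * 1 * (z ^ 0 * cnj z ^ 0))"
    unfolding V_def by blast
  thus ?thesis by simp
qed

lemma norm_avg_diff_le:
  assumes "\<And>u. u \<in># U \<Longrightarrow> norm (g u - h u) \<le> e" and "e \<ge> 0"
  shows "norm (avg U g - avg U h) \<le> e"
proof -
  have "norm ((\<Sum>u\<in>#U. g u) - (\<Sum>u\<in>#U. h u)) \<le> of_nat (size U) * e"
    using assms(1)
  proof (induction U)
    case (add u U)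
    have "norm ((g u - h u) + ((\<Sum>u\<in>#U. g u) - (\<Sum>u\<in>#U. h u))) \<le> e + of_nat (size U) * e"
      using add by (intro norm_triangle_mono) auto
    thus ?case by (simp add: algebra_simps)
  qed simp
  thus ?thesis
    using assms(2) by (cases "U = {#}")
      (simp_all add: avg_def norm_divide pos_divide_le_eq mult.commute nonempty_has_size
        flip: diff_divide_distrib)
qed

lemma norm_circle_mean_diff_le:
  assumes "continuous_on (sphere 0 1) g" "continuous_on (sphere 0 1) h"
    and "\<And>z. norm z = 1 \<Longrightarrow> norm (g z - h z) \<le> e" and "e \<ge> 0"
  shows "norm (circle_mean g - circle_mean h) \<le> e"
proof -
  have "((\<lambda>t. g (cis t) - h (cis t)) has_integral
          (integral {0..2*pi} (\<lambda>t. g (cis t)) - integral {0..2*pi} (\<lambda>t. h (cis t)))) {0..2*pi}"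
    using assms by (intro has_integral_diff integrable_integral integrable_cis_comp)
  hence "norm (integral {0..2*pi} (\<lambda>t. g (cis t)) - integral {0..2*pi} (\<lambda>t. h (cis t))) \<le> e * measure lborel {0..2*pi}"
    using assms by (intro has_integral_bound_real) auto
  thus ?thesis
    by (simp add: circle_mean_def norm_divide field_simps norm_mult flip: diff_divide_distrib)
qed

text \<open>
  By the Stone--Weierstrass theorem, \<open>g\<close> is uniformly close on the circle to a real polynomial function, and
  uniformly close functions have close averages over \<open>U i\<close> and close means over the circle.
\<close>

lemma averages_tendsto_continuous:
  fixes g :: "complex \<Rightarrow> real"
  assumes unit: "\<And>i u. u \<in># U i \<Longrightarrow> norm u = 1"
    and monomials: "\<And>j k. averages_tendsto F U (\<lambda>z. z ^ j * cnj z ^ k)"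
    and cont: "continuous_on (sphere 0 1) g"
  shows "averages_tendsto F U (\<lambda>z. of_real (g z))"
  unfolding averages_tendsto_def
proof
  show contg: "continuous_on (sphere 0 1) (\<lambda>z. complex_of_real (g z))"
    using cont by (intro continuous_intros)
  show "((\<lambda>i. avg (U i) (\<lambda>z. complex_of_real (g z))) \<longlongrightarrow> circle_mean (\<lambda>z. complex_of_real (g z))) F"
  proof (rule tendstoI)
    fix e :: real assume e: "e > 0"
    obtain p where p: "real_polynomial_function p" "\<And>z. z \<in> sphere 0 1 \<Longrightarrow> \<bar>g z - p z\<bar> < e / 3"
      using Stone_Weierstrass_real_polynomial_function[OF compact_sphere cont, of "e / 3"] e by auto
    define gc pc where "gc = (\<lambda>z. complex_of_real (g z))" and "pc = (\<lambda>z. complex_of_real (p z))"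
    have close: "norm (gc z - pc z) \<le> e / 3" if "norm z = 1" for z
      using p(2)[of z] that by (simp add: gc_def pc_def flip: of_real_diff)
    have pc: "averages_tendsto F U pc"
      unfolding pc_def using p(1) monomials by (rule averages_tendsto_real_polynomial)
    have "\<forall>\<^sub>F i in F. dist (avg (U i) pc) (circle_mean pc) < e / 3"
      using pc e unfolding averages_tendsto_def by (intro tendstoD) simp_all
    thus "\<forall>\<^sub>F i in F. dist (avg (U i) (\<lambda>z. complex_of_real (g z))) (circle_mean (\<lambda>z. complex_of_real (g z))) < e"
    proof eventually_elim
      case (elim i)
      have "norm (avg (U i) gc - avg (U i) pc) \<le> e / 3"
        using e close unit by (intro norm_avg_diff_le) auto
      moreover have "norm (circle_mean gc - circle_mean pc) \<le> e / 3"
        using e close contg pc by (intro norm_circle_mean_diff_le) (auto simp: averages_tendsto_def gc_def)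
      ultimately have "dist (avg (U i) gc) (circle_mean gc) < e"
        using elim unfolding dist_norm by norm
      thus ?case by (simp add: gc_def)
    qed
  qed
qed

lemma sum_mset_le_size_filter:
  fixes g :: "'a \<Rightarrow> real"
  assumes "\<And>u. u \<in># U \<Longrightarrow> g u \<le> of_bool (Q u)"
  shows "(\<Sum>u\<in>#U. g u) \<le> real (size (filter_mset Q U))"
  using assms
proof (induction U)
  case (add u U)
  have "g u + (\<Sum>u\<in>#U. g u) \<le> of_bool (Q u) + real (size (filter_mset Q U))"
    using add by (intro add_mono) auto
  thus ?case by (cases "Q u") simp_all
qed simp

section \<open>Counting points in arcs\<close>

text \<open>
  The arc with midpoint \<open>c\<close> and half-length \<open>w\<close> is the part of the circle in the half-plane
  \<open>Re (z * cis (- c)) > cos w\<close>. Clipping an affine function of \<open>Re (z * cis (- c))\<close> to the interval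
  from \<open>0\<close> to \<open>1\<close> therefore gives a continuous function on the plane with the required values, and avoids
  the jump of \<open>Arg2pi\<close> at the positive real axis.
\<close>

lemma arc_tent_function:
  assumes "0 \<le> \<theta>" "\<theta> < \<phi>" "\<phi> \<le> 2 * pi" and \<delta>: "0 < \<delta>" "\<delta> \<le> (\<phi> - \<theta>) / 2"
  obtains g :: "complex \<Rightarrow> real" where
    "continuous_on UNIV g" "\<And>z. 0 \<le> g z" "\<And>z. g z \<le> 1"
    "\<And>t. t \<in> {\<theta> + \<delta>..\<phi> - \<delta>} \<Longrightarrow> g (cis t) = 1"
    "\<And>t. t \<in> {0..2*pi} - {\<theta><..<\<phi>} \<Longrightarrow> g (cis t) = 0"
proof
  define c w where "c = (\<theta> + \<phi>) / 2" and "w = (\<phi> - \<theta>) / 2"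
  define a b where "a = cos w" and "b = cos (w - \<delta>)"
  define g where "g z = max 0 (min 1 ((Re (z * cis (- c)) - a) / (b - a)))" for z
  have w: "0 < w" "w \<le> pi" and wd: "0 \<le> w - \<delta>" using assms by (auto simp: w_def)
  have ab: "a < b" unfolding a_def b_def using w wd \<delta> by (intro cos_monotone_0_pi) auto
  have Re_cis: "Re (cis t * cis (- c)) = cos \<bar>t - c\<bar>" for t
    by (simp add: cis_mult)
  show "continuous_on UNIV g"
    unfolding g_def using ab by (intro continuous_intros) auto
  show "0 \<le> g z" "g z \<le> 1" for z by (auto simp: g_def)
  show "g (cis t) = 1" if "t \<in> {\<theta> + \<delta>..\<phi> - \<delta>}" for t
  proof -
    have "\<bar>t - c\<bar> \<le> w - \<delta>" using that unfolding c_def w_def by (auto simp: abs_le_iff field_simps)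
    hence "b \<le> cos \<bar>t - c\<bar>" unfolding b_def using w \<delta> by (intro cos_monotone_0_pi_le) auto
    hence "(Re (cis t * cis (- c)) - a) / (b - a) \<ge> 1" unfolding Re_cis using ab by simp
    thus ?thesis by (simp add: g_def)
  qed
  show "g (cis t) = 0" if "t \<in> {0..2*pi} - {\<theta><..<\<phi>}" for t
  proof -
    \<comment> \<open>The cosine is at most \<open>cos w\<close> on all of \<open>{w..2 * pi - w}\<close>, which is symmetric about \<open>pi\<close>.\<close>
    have far: "w \<le> \<bar>t - c\<bar>" "\<bar>t - c\<bar> \<le> 2 * pi - w"
      using that assms unfolding c_def w_def by (auto simp: abs_if field_simps)
    have "cos \<bar>t - c\<bar> \<le> a"
    proof (cases "\<bar>t - c\<bar> \<le> pi")
      case True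
      thus ?thesis unfolding a_def using far w by (intro cos_monotone_0_pi_le) auto
    next
      case False
      have "cos \<bar>t - c\<bar> = cos (2 * pi - \<bar>t - c\<bar>)" by (simp add: cos_diff)
      also have "\<dots> \<le> a" unfolding a_def using far w False by (intro cos_monotone_0_pi_le) auto
      finally show ?thesis .
    qed
    hence "(Re (cis t * cis (- c)) - a) / (b - a) \<le> 0"
      unfolding Re_cis using ab by (simp add: divide_le_0_iff)
    thus ?thesis by (simp add: g_def)
  qed
qed

definition arc_ratio :: "complex multiset \<Rightarrow> real \<Rightarrow> real \<Rightarrow> real" where
  "arc_ratio U \<theta> \<phi> = real (size {#u \<in># U. \<theta> \<le> Arg2pi u \<and> Arg2pi u < \<phi>#}) / real (size U)"

text \<open>
  Averages over \<open>U i\<close> of a continuous function \<open>g \<ge> 0\<close> that is dominated by the indicator of the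
  arc and equals \<open>1\<close> on a slightly shorter arc are at most \<open>arc_ratio\<close>, and converge to at least the proportion of the shorter arc.
\<close>

lemma arc_ratio_lower_bound:
  fixes U :: "'i \<Rightarrow> complex multiset"
  assumes unit: "\<And>i u. u \<in># U i \<Longrightarrow> norm u = 1"
    and monomials: "\<And>j k. averages_tendsto F U (\<lambda>z. z ^ j * cnj z ^ k)"
    and \<theta>\<phi>: "0 \<le> \<theta>" "\<theta> \<le> \<phi>" "\<phi> \<le> 2 * pi" and e: "e > 0"
  shows "\<forall>\<^sub>F i in F. (\<phi> - \<theta>) / (2 * pi) - e < arc_ratio (U i) \<theta> \<phi>"
proof (cases "\<theta> = \<phi>")
  case True
  have "0 \<le> arc_ratio (U i) \<theta> \<phi>" for i by (simp add: arc_ratio_def)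
  hence "(\<phi> - \<theta>) / (2 * pi) - e < arc_ratio (U i) \<theta> \<phi>" for i
    using True e by (simp add: less_le_trans[of "- e" 0])
  thus ?thesis by simp
next
  case False
  \<comment> \<open>Shortening the arc by \<open>\<delta>\<close> at both ends costs the proportion \<open>\<delta> / pi\<close> of the circle.\<close>
  define \<delta> where "\<delta> = min ((\<phi> - \<theta>) / 2) (pi * e / 2)"
  have \<delta>: "0 < \<delta>" "\<delta> \<le> (\<phi> - \<theta>) / 2" "\<delta> / pi < e"
    using False \<theta>\<phi> e by (auto simp: \<delta>_def min_def field_simps)
  obtain g :: "complex \<Rightarrow> real" where cont: "continuous_on UNIV g"
    and g: "\<And>z. 0 \<le> g z" "\<And>z. g z \<le> 1"
      "\<And>t. t \<in> {\<theta> + \<delta>..\<phi> - \<delta>} \<Longrightarrow> g (cis t) = 1"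
      "\<And>t. t \<in> {0..2*pi} - {\<theta><..<\<phi>} \<Longrightarrow> g (cis t) = 0"
    using arc_tent_function[of \<theta> \<phi> \<delta>] \<theta>\<phi> \<delta> False by (metis order_le_less)
  have cont': "continuous_on (sphere 0 1) g" using cont continuous_on_subset by blast
  define M where "M = integral {0..2*pi} (\<lambda>t. g (cis t)) / (2 * pi)"
  have "\<phi> - \<theta> - 2 * \<delta> = integral {\<theta> + \<delta>..\<phi> - \<delta>} (\<lambda>t. 1 :: real)"
    using \<delta> by simp
  also have "\<dots> = integral {\<theta> + \<delta>..\<phi> - \<delta>} (\<lambda>t. g (cis t))"
    using g(3) by (intro integral_cong) simp
  also have "\<dots> \<le> integral {0..2*pi} (\<lambda>t. g (cis t))"
    using \<theta>\<phi> \<delta> g(1) cont' by (intro integral_subset_le integrable_cis_comp) auto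
  finally have "(\<phi> - \<theta> - 2 * \<delta>) / (2 * pi) \<le> M"
    unfolding M_def by (intro divide_right_mono) auto
  hence M: "(\<phi> - \<theta>) / (2 * pi) - e < M"
    using \<delta>(3) by (simp add: diff_divide_distrib)
  have "averages_tendsto F U (\<lambda>z. of_real (g z))"
    using unit monomials cont' by (rule averages_tendsto_continuous)
  hence "((\<lambda>i. Re (avg (U i) (\<lambda>z. of_real (g z)))) \<longlongrightarrow> Re (circle_mean (\<lambda>z. of_real (g z)))) F"
    unfolding averages_tendsto_def by (intro tendsto_Re) simp
  moreover have "Re (circle_mean (\<lambda>z. of_real (g z))) = M"
  proof -
    have "integral {0..2*pi} (\<lambda>t. complex_of_real (g (cis t))) = of_real (integral {0..2*pi} (\<lambda>t. g (cis t)))"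
      by (intro integral_unique has_integral_of_real integrable_integral integrable_cis_comp cont')
    hence "circle_mean (\<lambda>z. of_real (g z)) = of_real M"
      by (simp add: circle_mean_def M_def)
    thus ?thesis by simp
  qed
  ultimately have "\<forall>\<^sub>F i in F. (\<phi> - \<theta>) / (2 * pi) - e < Re (avg (U i) (\<lambda>z. of_real (g z)))"
    using M by (auto dest: order_tendstoD(1))
  thus ?thesis
  proof eventually_elim
    case (elim i)
    have "(\<Sum>u\<in>#U i. g u) \<le> real (size {#u \<in># U i. \<theta> \<le> Arg2pi u \<and> Arg2pi u < \<phi>#})"
    proof (rule sum_mset_le_size_filter)
      fix u assume "u \<in># U i"
      hence "u = cis (Arg2pi u)"
        using unit Arg2pi_eq[of u] by (simp add: cis_conv_exp mult.commute)
      moreover have "Arg2pi u \<in> {0..2*pi}" using Arg2pi_ge_0[of u] Arg2pi_lt_2pi[of u] by simp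
      ultimately have "g u = 0" if "\<not> (\<theta> \<le> Arg2pi u \<and> Arg2pi u < \<phi>)"
        using g(4)[of "Arg2pi u"] that by auto
      thus "g u \<le> of_bool (\<theta> \<le> Arg2pi u \<and> Arg2pi u < \<phi>)" using g(2) by auto
    qed
    moreover have "(\<Sum>u\<in>#V. complex_of_real (g u)) = of_real (\<Sum>u\<in>#V. g u)" for V
      by (induction V) auto
    hence "avg (U i) (\<lambda>z. of_real (g z)) = of_real ((\<Sum>u\<in>#U i. g u) / real (size (U i)))"
      by (simp add: avg_def)
    hence "Re (avg (U i) (\<lambda>z. of_real (g z))) = (\<Sum>u\<in>#U i. g u) / real (size (U i))"
      by (simp only: Re_complex_of_real)
    ultimately show ?case
      using elim unfolding arc_ratio_def by (smt (verit) divide_right_mono of_nat_0_le_iff)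
  qed
qed

text \<open>
  Lower bounds are enough: the arcs from \<open>0\<close> to \<open>\<theta>\<close>, from \<open>\<theta>\<close> to \<open>\<phi>\<close> and from \<open>\<phi>\<close> to \<open>2 * pi\<close>
  partition the circle, so the lower bounds for the two outer arcs give the upper bound for the middle one.
\<close>

lemma arc_ratio_tendsto:
  fixes U :: "'i \<Rightarrow> complex multiset"
  assumes unit: "\<And>i u. u \<in># U i \<Longrightarrow> norm u = 1"
    and ne: "\<forall>\<^sub>F i in F. U i \<noteq> {#}"
    and power_sums: "\<And>m. m > 0 \<Longrightarrow> ((\<lambda>i. avg (U i) (\<lambda>u. u ^ m)) \<longlongrightarrow> 0) F"
    and \<theta>\<phi>: "0 \<le> \<theta>" "\<theta> \<le> \<phi>" "\<phi> \<le> 2 * pi"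
  shows "((\<lambda>i. arc_ratio (U i) \<theta> \<phi>) \<longlongrightarrow> (\<phi> - \<theta>) / (2 * pi)) F"
proof (rule tendstoI)
  fix e :: real assume e: "e > 0"
  note lower = arc_ratio_lower_bound[OF unit averages_tendsto_monomial[OF unit ne power_sums]]
  have total: "arc_ratio (U i) 0 \<theta> + arc_ratio (U i) \<theta> \<phi> + arc_ratio (U i) \<phi> (2 * pi) = 1" if "U i \<noteq> {#}" for i
  proof -
    have "size {#u \<in># V. 0 \<le> Arg2pi u \<and> Arg2pi u < \<theta>#} + size {#u \<in># V. \<theta> \<le> Arg2pi u \<and> Arg2pi u < \<phi>#}
            + size {#u \<in># V. \<phi> \<le> Arg2pi u \<and> Arg2pi u < 2 * pi#} = size V" for V
    proof (induction V)
      case (add u V)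
      thus ?case using \<theta>\<phi> Arg2pi_ge_0[of u] Arg2pi_lt_2pi[of u] by auto
    qed simp
    from this[of "U i"] show ?thesis
      using that unfolding arc_ratio_def add_divide_distrib[symmetric] of_nat_add[symmetric]
      by simp
  qed
  have "\<forall>\<^sub>F i in F. (\<theta> - 0) / (2 * pi) - e / 2 < arc_ratio (U i) 0 \<theta>"
    using \<theta>\<phi> e by (intro lower) auto
  moreover have "\<forall>\<^sub>F i in F. (\<phi> - \<theta>) / (2 * pi) - e < arc_ratio (U i) \<theta> \<phi>"
    using \<theta>\<phi> e by (intro lower) auto
  moreover have "\<forall>\<^sub>F i in F. (2 * pi - \<phi>) / (2 * pi) - e / 2 < arc_ratio (U i) \<phi> (2 * pi)"
    using \<theta>\<phi> e by (intro lower) auto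
  ultimately show "\<forall>\<^sub>F i in F. dist (arc_ratio (U i) \<theta> \<phi>) ((\<phi> - \<theta>) / (2 * pi)) < e"
    using ne
  proof eventually_elim
    case (elim i)
    have "(\<theta> - 0) / (2 * pi) + (\<phi> - \<theta>) / (2 * pi) + (2 * pi - \<phi>) / (2 * pi) = 1"
      by (simp flip: add_divide_distrib)
    with elim total[of i] show ?case unfolding dist_real_def by linarith
  qed
qed

section \<open>Application to polynomials\<close>

text \<open>
  Dividing the polynomial by \<open>sqrt (norm (coeff p 0) * norm (coeff p N))\<close> is the same as dividing each
  of its root factors by \<open>sqrt (norm w)\<close>, because the product of the roots has modulus
  \<open>norm (coeff p 0) / norm (coeff p N)\<close>. This is why \<open>L_functional\<close> controls the normalised product.
\<close>

lemma prod_roots_le_exp_L_functional: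
  assumes deg: "degree p = N" and nz: "coeff p 0 \<noteq> 0" and z: "norm z = 1"
  shows "(\<Prod>w\<in>#proots p. norm (z - w) / sqrt (norm w)) \<le> exp (L_functional N p)"
proof -
  define S where "S = (\<Sum>k\<le>N. norm (coeff p k))"
  define l where "l = norm (coeff p N)"
  define W where "W = (\<Prod>w\<in>#proots p. norm w)"
  have "p \<noteq> 0" using nz by auto
  hence l: "l > 0" using deg by (auto simp: l_def)
  have poly_norm: "norm (poly p x) = l * (\<Prod>w\<in>#proots p. norm (x - w))" for x
  proof -
    have "poly p x = coeff p N * (\<Prod>w\<in>#proots p. x - w)"
      by (subst complex_poly_decompose_multiset[of p, symmetric]) (simp add: deg poly_prod_mset)
    thus ?thesis by (simp add: l_def norm_mult norm_prod_mset)
  qed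
  have c0: "norm (coeff p 0) = l * W"
    using poly_norm[of 0] by (simp add: W_def poly_0_coeff_0)
  hence W: "W > 0" using nz l by (metis zero_less_mult_pos zero_less_norm_iff)
  have "l * (\<Prod>w\<in>#proots p. norm (z - w)) \<le> S"
  proof -
    have "norm (poly p z) \<le> (\<Sum>k\<le>N. norm (coeff p k * z ^ k))"
      unfolding poly_altdef deg by (rule norm_sum)
    thus ?thesis by (simp add: poly_norm S_def norm_mult norm_power z)
  qed
  hence S: "(\<Prod>w\<in>#proots p. norm (z - w)) \<le> S / l" using l by (simp add: field_simps)
  have "S \<ge> norm (coeff p 0)" unfolding S_def by (rule member_le_sum) auto
  hence Spos: "S > 0" using nz by (metis less_le_trans zero_less_norm_iff)
  have "(\<Prod>w\<in>#A. norm (z - w) / sqrt (norm w)) = (\<Prod>w\<in>#A. norm (z - w)) / sqrt (\<Prod>w\<in>#A. norm w)" for A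
    by (induction A) (simp_all add: real_sqrt_mult)
  hence "(\<Prod>w\<in>#proots p. norm (z - w) / sqrt (norm w)) = (\<Prod>w\<in>#proots p. norm (z - w)) / sqrt W"
    by (simp add: W_def)
  also have "\<dots> \<le> S / l / sqrt W"
    using S W by (intro divide_right_mono) auto
  also have "\<dots> = exp (ln (S / l / sqrt W))"
    using Spos l W by simp
  also have "ln (S / l / sqrt W) = L_functional N p"
    using Spos l W by (simp add: L_functional_def c0 ln_div ln_mult ln_sqrt field_simps flip: S_def l_def)
  finally show ?thesis .
qed

theorem theorem1:
  fixes P :: "nat \<Rightarrow> complex poly" and a :: "nat \<Rightarrow> nat \<Rightarrow> complex"
  assumes "\<And>N. N \<ge> 1 \<Longrightarrow> P N = (\<Sum>k\<le>N. monom (a N k) k)"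
    and "\<And>N. N \<ge> 1 \<Longrightarrow> a N 0 * a N N \<noteq> 0"
    and "(\<lambda>N. L_functional N (P N)) \<in> o(\<lambda>N. real N)"
  shows "(\<forall>\<rho>::real. 0 < \<rho> \<and> \<rho> < 1 \<longrightarrow>
            (\<lambda>N. 1 / real N * real (nu_annulus (P N) \<rho>)) \<longlonglongrightarrow> 1) \<and>
         (\<forall>\<theta> \<phi>::real. 0 \<le> \<theta> \<and> \<theta> < \<phi> \<and> \<phi> \<le> 2 * pi \<longrightarrow>
            (\<lambda>N. 1 / real N * real (nu_sector (P N) \<theta> \<phi>)) \<longlonglongrightarrow> (\<phi> - \<theta>) / (2 * pi))"
proof -
  define L where "L N = L_functional N (P N)" for N
  have L: "(\<lambda>N. L N / real N) \<longlonglongrightarrow> 0"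
    using smalloD_tendsto[OF assms(3)] by (simp add: L_def)
  have coeff: "coeff (P N) k = (if k \<le> N then a N k else 0)" if "N \<ge> 1" for N k
    by (simp add: assms(1)[OF that] coeff_sum)
  have deg: "degree (P N) = N" and P0: "coeff (P N) 0 \<noteq> 0" if "N \<ge> 1" for N
  proof -
    have "a N 0 \<noteq> 0" "a N N \<noteq> 0" using assms(2)[OF that] by auto
    thus "degree (P N) = N" "coeff (P N) 0 \<noteq> 0"
      using that by (auto simp: coeff intro!: antisym degree_le le_degree)
  qed
  define Z where "Z N = proots (P N)" for N
  have nz: "0 \<notin># Z N" if "N \<ge> 1" for N
  proof -
    have "P N \<noteq> 0" using P0[OF that] by auto
    thus ?thesis using P0[OF that] by (simp add: Z_def poly_0_coeff_0)
  qed
  have size: "size (Z N) = N" if "N \<ge> 1" for N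
    using deg[OF that] by (simp add: Z_def size_proots_complex)
  have circle: "(\<Prod>w\<in>#Z N. norm (z - w) / sqrt (norm w)) \<le> exp (L N)" if "N \<ge> 1" "norm z = 1" for N z
    unfolding Z_def L_def using that deg P0 by (intro prod_roots_le_exp_L_functional) auto

  have annulus: "(\<lambda>N. 1 / real N * real (nu_annulus (P N) \<rho>)) \<longlonglongrightarrow> 1" if \<rho>: "0 < \<rho>" "\<rho> < 1" for \<rho>
  proof (rule tendsto_sandwich)
    define \<kappa> where "\<kappa> = - ln (1 - \<rho>)"
    have \<kappa>: "\<kappa> > 0" using \<rho> by (simp add: \<kappa>_def)
    show "(\<lambda>N. 1 - 2 / \<kappa> * (L N / real N)) \<longlonglongrightarrow> 1"
      using tendsto_diff[OF tendsto_const tendsto_mult_left[OF L], of 1 "2 / \<kappa>"] by simp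
    have bounds: "1 - 2 / \<kappa> * (L N / real N) \<le> 1 / real N * real (nu_annulus (P N) \<rho>)
                    \<and> 1 / real N * real (nu_annulus (P N) \<rho>) \<le> 1" if N: "N \<ge> 1" for N
    proof -
      define out where "out = size {#w \<in># Z N. \<not> (1 - \<rho> \<le> norm w \<and> norm w \<le> 1 / (1 - \<rho>))#}"
      have "nu_annulus (P N) \<rho> + out = size (Z N)"
        unfolding nu_annulus_def out_def Z_def by (metis multiset_partition size_union)
      hence nu: "real (nu_annulus (P N) \<rho>) = real N - real out"
        using size[OF N] by linarith
      have "real out * \<kappa> \<le> 2 * L N"
        using size_outside_annulus_le[OF nz[OF N] \<rho>] sum_abs_ln_norm_le[OF nz[OF N] circle[OF N]]
        unfolding out_def \<kappa>_def by linarith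
      hence "real out \<le> 2 * L N / \<kappa>" using \<kappa> by (simp add: field_simps)
      hence "real out / real N \<le> 2 * L N / \<kappa> / real N" by (intro divide_right_mono) auto
      thus ?thesis using N unfolding nu by (simp add: diff_divide_distrib)
    qed
    show "\<forall>\<^sub>F N in sequentially. 1 - 2 / \<kappa> * (L N / real N) \<le> 1 / real N * real (nu_annulus (P N) \<rho>)"
      "\<forall>\<^sub>F N in sequentially. 1 / real N * real (nu_annulus (P N) \<rho>) \<le> 1"
      by (rule eventually_mono[OF eventually_ge_at_top[of "1::nat"]], use bounds in blast)+
  qed simp

  \<comment> \<open>\<open>P 0\<close> is arbitrary, and a root \<open>0\<close> of it would give the point \<open>sgn 0 = 0\<close> off the circle.\<close>
  define U where "U N = (if N \<ge> 1 then image_mset sgn (Z N) else {#})" for N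
  have U: "U N = image_mset sgn (Z N)" if "N \<ge> 1" for N using that by (simp add: U_def)
  have unit: "norm u = 1" if "u \<in># U N" for N u
    using that nz[of N] by (auto simp: U_def norm_sgn split: if_splits)
  have ne: "\<forall>\<^sub>F N in sequentially. U N \<noteq> {#}"
    using eventually_ge_at_top[of "1::nat"] by eventually_elim (use size in \<open>fastforce simp: U\<close>)
  have power_sums: "(\<lambda>N. avg (U N) (\<lambda>u. u ^ m)) \<longlonglongrightarrow> 0" if m: "m > 0" for m
  proof (rule Lim_null_comparison)
    show "(\<lambda>N. 2 * real m * (L N / real N)) \<longlonglongrightarrow> 0"
      using tendsto_mult_left[OF L, of "2 * real m"] by simp
    show "\<forall>\<^sub>F N in sequentially. norm (avg (U N) (\<lambda>u. u ^ m)) \<le> 2 * real m * (L N / real N)"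
      using eventually_ge_at_top[of "1::nat"]
    proof eventually_elim
      case N: (elim N)
      have "norm (\<Sum>u\<in>#U N. u ^ m) \<le> 2 * (real m * L N)"
      proof (rule norm_power_sum_le[OF unit m])
        fix z :: complex assume z: "norm z = 1"
        have "(\<Prod>u\<in>#U N. norm (z - u)) = (\<Prod>w\<in>#Z N. norm (z - sgn w))"
          by (simp add: U[OF N] image_mset.compositionality comp_def)
        also have "\<dots> \<le> (\<Prod>w\<in>#Z N. norm (z - w) / sqrt (norm w))"
        proof (intro conjunct2[OF prod_mset_mono_real] conjI)
          fix w assume "w \<in># Z N"
          hence "w \<noteq> 0" using nz[OF N] by metis
          thus "norm (z - sgn w) \<le> norm (z - w) / sqrt (norm w)" by (rule norm_diff_sgn_le[OF z])
        qed simp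
        also have "\<dots> \<le> exp (L N)" by (rule circle[OF N z])
        finally show "(\<Prod>u\<in>#U N. norm (z - u)) \<le> exp (L N)" .
      qed
      hence "norm (\<Sum>u\<in>#U N. u ^ m) / real N \<le> 2 * (real m * L N) / real N"
        by (intro divide_right_mono) auto
      thus ?case by (simp add: avg_def norm_divide U[OF N] size[OF N])
    qed
  qed
  have Arg2pi_sgn: "Arg2pi (sgn w) = Arg2pi w" if "w \<noteq> 0" for w
  proof -
    have "w = of_real (norm w) * sgn w" using that by (simp add: sgn_eq)
    thus ?thesis using that by (metis Arg2pi_times_of_real zero_less_norm_iff)
  qed
  have sector: "(\<lambda>N. 1 / real N * real (nu_sector (P N) \<theta> \<phi>)) \<longlonglongrightarrow> (\<phi> - \<theta>) / (2 * pi)"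
    if \<theta>\<phi>: "0 \<le> \<theta>" "\<theta> < \<phi>" "\<phi> \<le> 2 * pi" for \<theta> \<phi>
  proof (rule Lim_transform_eventually)
    show "(\<lambda>N. arc_ratio (U N) \<theta> \<phi>) \<longlonglongrightarrow> (\<phi> - \<theta>) / (2 * pi)"
      using \<theta>\<phi> by (intro arc_ratio_tendsto[OF unit ne power_sums]) auto
    show "\<forall>\<^sub>F N in sequentially. arc_ratio (U N) \<theta> \<phi> = 1 / real N * real (nu_sector (P N) \<theta> \<phi>)"
      using eventually_ge_at_top[of "1::nat"]
    proof eventually_elim
      case N: (elim N)
      have "{#w \<in># Z N. \<theta> \<le> Arg2pi (sgn w) \<and> Arg2pi (sgn w) < \<phi>#} = {#w \<in># Z N. \<theta> \<le> Arg2pi w \<and> Arg2pi w < \<phi>#}"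
        using nz[OF N] by (intro filter_mset_cong) (metis Arg2pi_sgn)+
      thus ?case
        by (simp add: arc_ratio_def U[OF N] size[OF N] nu_sector_def filter_mset_image_mset flip: Z_def)
    qed
  qed
  show ?thesis using annulus sector by blast
qed

end
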